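(* Let $f:\mathbb{R}^m\to\mathbb{R}$ be differentiable with $f(\boldsymbol{x})\ge\delta>0$ for all $\boldsymbol{x}$, and let $\psi\in(0,1)$. The E-RSAV algorithm is unconditionally energy dissipative: for every step size $\Delta t>0$ and every $n\ge 0$, any iterates $(\boldsymbol{x}^n,\boldsymbol{r}^n)$ of the E-RSAV algorithm satisfy $$\|\boldsymbol{r}^{n+1}\|^2-\|\boldsymbol{r}^{n}\|^2\le-(\mathcal{L}^{n}(\boldsymbol{x}^{n+1}-\boldsymbol{x}^n),\boldsymbol{x}^{n+1}-\boldsymbol{x}^{n})-\frac{1-\psi}{\Delta t}\|\boldsymbol{x}^{n+1}-\boldsymbol{x}^n\|^2\le 0.$$ In particular, if $(\mathcal{L}^{n}\boldsymbol{x})_i=\lambda_i^n x_i$ with $\lambda_i^n\ge 0$ for all $i,n$, then $$(r_i^{n+1})^2-(r_i^{n})^2\le-\frac{1-\psi}{\Delta t}(x_i^{n+1}-x_i^{n})^2\le 0\quad\text{for }1\le i\le m.$$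
   Context: $(\cdot,\cdot)$ and $\|\cdot\|$ are the Euclidean inner product and norm on $\mathbb{R}^m$; $\boldsymbol{x}=(x_1,\dots,x_m)$, $\boldsymbol{r}=(r_1,\dots,r_m)$. For each $n$, $\mathcal{L}^n$ is a self-adjoint positive semi-definite linear operator on $\mathbb{R}^m$. The E-RSAV algorithm (element-wise relaxed scalar auxiliary variable scheme) with step size $\Delta t>0$ and parameter $\psi\in(0,1)$ starts from $\boldsymbol{x}^0\in\mathbb{R}^m$ and $r_i^0=\sqrt{f(\boldsymbol{x}^0)}$, and determines $(\boldsymbol{x}^{n+1},\boldsymbol{r}^{n+1})$ from $(\boldsymbol{x}^n,\boldsymbol{r}^n)$, via intermediate values $\tilde r_i^{n+1}$, by, for $i=1,\dots,m$, $$\frac{x_i^{n+1}-x_i^{n}}{\Delta t}+(\mathcal{L}^{n}(\boldsymbol{x}^{n+1}-\boldsymbol{x}^{n}))_i+\frac{\tilde r_i^{n+1}}{\sqrt{f(\boldsymbol{x}^n)}}\frac{\partial f(\boldsymbol{x}^n)}{\partial x_i}=0,$$ $$\frac{\tilde r_i^{n+1}-r_i^{n}}{\Delta t}=\frac{1}{2\sqrt{f(\boldsymbol{x}^n)}}\frac{\partial f(\boldsymbol{x}^n)}{\partial x_i}\,\frac{x_i^{n+1}-x_i^{n}}{\Delta t},$$ $$r_i^{n+1}=\eta_{i0}\,\tilde r_i^{n+1}+(1-\eta_{i0})\sqrt{f(\boldsymbol{x}^{n+1})},$$ where $\eta_{i0}$ (depending on $n$) is the smallest number in $[0,1]$ such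 that $$(r_i^{n+1})^2-(\tilde r_i^{n+1})^2\le\frac{\psi}{\Delta t}(x_i^{n+1}-x_i^{n})^2.$$ *)

theory Defs
  imports "HOL-Analysis.Analysis"
begin

definition partial_deriv :: "(real ^ 'm \<Rightarrow> real) \<Rightarrow> 'm::finite \<Rightarrow> real ^ 'm \<Rightarrow> real" where
  "partial_deriv f i x = deriv (\<lambda>t. f (x + t *\<^sub>R axis i 1)) 0"

definition selfadjoint_psd :: "(real ^ 'm \<Rightarrow> real ^ 'm::finite) \<Rightarrow> bool" where
  "selfadjoint_psd A \<longleftrightarrow> linear A \<and> adjoint A = A \<and> (\<forall>v. 0 \<le> A v \<bullet> v)"

(* One component of the relaxation, with q the value sqrt (f x') at the new point, rt the
   intermediate auxiliary value and d the increment of that component of x. *)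
definition relax_value :: "real \<Rightarrow> real \<Rightarrow> real \<Rightarrow> real" where
  "relax_value \<eta> rt q = \<eta> * rt + (1 - \<eta>) * q"

definition relax_admissible :: "real \<Rightarrow> real \<Rightarrow> real \<Rightarrow> real \<Rightarrow> real \<Rightarrow> real set" where
  "relax_admissible dt \<psi> rt q d =
     {\<eta> \<in> {0..1}. (relax_value \<eta> rt q)\<^sup>2 - rt\<^sup>2 \<le> \<psi> / dt * d\<^sup>2}"

definition smallest_in :: "real \<Rightarrow> real set \<Rightarrow> bool" where
  "smallest_in a S \<longleftrightarrow> a \<in> S \<and> (\<forall>b\<in>S. a \<le> b)"

(* The scheme is implicit in the new values (x', r'), so a step is a relation; rt is the
   vector of intermediate values and \<eta> that of the relaxation parameters. *)
definition ersav_step ::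
  "(real ^ 'm \<Rightarrow> real) \<Rightarrow> (real ^ 'm \<Rightarrow> real ^ 'm) \<Rightarrow> real \<Rightarrow> real \<Rightarrow>
   real ^ 'm \<Rightarrow> real ^ 'm \<Rightarrow> real ^ 'm \<Rightarrow> real ^ 'm::finite \<Rightarrow> bool" where
  "ersav_step f A dt \<psi> x r x' r' \<longleftrightarrow>
     (\<exists>rt \<eta> :: real ^ 'm. \<forall>i.
        (x' $ i - x $ i) / dt + A (x' - x) $ i + rt $ i / sqrt (f x) * partial_deriv f i x = 0 \<and>
        (rt $ i - r $ i) / dt =
          1 / (2 * sqrt (f x)) * partial_deriv f i x * ((x' $ i - x $ i) / dt) \<and>
        smallest_in (\<eta> $ i)
          (relax_admissible dt \<psi> (rt $ i) (sqrt (f x')) (x' $ i - x $ i)) \<and>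
        r' $ i = relax_value (\<eta> $ i) (rt $ i) (sqrt (f x')))"

definition ersav_iterates ::
  "(real ^ 'm \<Rightarrow> real) \<Rightarrow> (nat \<Rightarrow> real ^ 'm \<Rightarrow> real ^ 'm) \<Rightarrow> real \<Rightarrow> real \<Rightarrow>
   (nat \<Rightarrow> real ^ 'm) \<Rightarrow> (nat \<Rightarrow> real ^ 'm::finite) \<Rightarrow> bool" where
  "ersav_iterates f L dt \<psi> x r \<longleftrightarrow>
     (\<forall>i. r 0 $ i = sqrt (f (x 0))) \<and>
     (\<forall>n. ersav_step f (L n) dt \<psi> (x n) (r n) (x (Suc n)) (r (Suc n)))"

end

theory Submission
  imports Defs
begin

text \<open>
  The scheme dissipates energy one component at a time. In the identity
  \<open>rt\<^sup>2 - r\<^sup>2 = 2 * rt * (rt - r) - (rt - r)\<^sup>2\<close> the discrete chain rule of the scheme turns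
  \<open>2 * rt * (rt - r)\<close> into the gradient force times the increment \<open>d\<close>, and the equation of
  motion rewrites that as \<open>- d\<^sup>2 / dt - a * d\<close>, where \<open>a\<close> is the component of the operator
  term. The relaxation may give back at most \<open>\<psi> / dt * d\<^sup>2\<close> of the term \<open>- d\<^sup>2 / dt\<close>, so the
  energy of the component changes by at most \<open>- a * d - (1 - \<psi>) / dt * d\<^sup>2\<close>
  (\<open>ersav_step_component_dissipation\<close>).

  Summation over the components turns the products \<open>a * d\<close> into the inner product with the
  operator term, which is nonnegative although its individual summands may not be. When the
  operator is diagonal with nonnegative entries, each summand is already nonnegative, and the
  bound holds for every component separately.
\<close>

text \<open>
  The dissipation law before relaxation; here \<open>s\<close> stands for \<open>sqrt (f x)\<close> and \<open>g\<close> for the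
  partial derivative. Multiplying the equation of motion by \<open>d\<close> produces the same product
  \<open>rt * g * d / s\<close> as multiplying the auxiliary equation by \<open>2 * rt\<close>; eliminating it leaves
  the dissipation terms and a square with a favourable sign.
\<close>

lemma intermediate_energy_identity:
  fixes d a rt r s g dt :: real
  assumes dt: "dt \<noteq> 0"
    and motion: "d / dt + a + rt / s * g = 0"
    and chain: "(rt - r) / dt = 1 / (2 * s) * g * (d / dt)"
  shows "rt\<^sup>2 - r\<^sup>2 = - (a * d) - d\<^sup>2 / dt - (rt - r)\<^sup>2"
proof -
  have incr: "rt - r = g * d / (2 * s)"
    using chain dt by (simp add: field_simps)
  have "2 * rt * (rt - r) = (rt / s * g) * d"
    unfolding incr by simp
  also have "rt / s * g = - (d / dt) - a"
    using motion by linarith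
  finally have "2 * rt * (rt - r) = - (a * d) - d\<^sup>2 / dt"
    by (simp add: algebra_simps power2_eq_square)
  then show ?thesis
    by (simp add: algebra_simps power2_eq_square)
qed

lemma ersav_step_component_dissipation:
  fixes x r x' r' :: "real ^ 'm::finite"
  assumes dt: "dt \<noteq> 0" and step: "ersav_step f A dt \<psi> x r x' r'"
  shows "(r' $ i)\<^sup>2 - (r $ i)\<^sup>2
           \<le> - (A (x' - x) $ i * (x' $ i - x $ i)) - (1 - \<psi>) / dt * (x' $ i - x $ i)\<^sup>2"
proof -
  obtain rt \<eta> :: "real ^ 'm" where
    motion: "(x' $ i - x $ i) / dt + A (x' - x) $ i + rt $ i / sqrt (f x) * partial_deriv f i x = 0"
    and chain: "(rt $ i - r $ i) / dt =
          1 / (2 * sqrt (f x)) * partial_deriv f i x * ((x' $ i - x $ i) / dt)"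
    and small: "smallest_in (\<eta> $ i)
          (relax_admissible dt \<psi> (rt $ i) (sqrt (f x')) (x' $ i - x $ i))"
    and relax: "r' $ i = relax_value (\<eta> $ i) (rt $ i) (sqrt (f x'))"
    using step unfolding ersav_step_def by blast
  have "(r' $ i)\<^sup>2 - (rt $ i)\<^sup>2 \<le> \<psi> / dt * (x' $ i - x $ i)\<^sup>2"
    using small unfolding relax smallest_in_def relax_admissible_def by simp
  moreover have "(rt $ i)\<^sup>2 - (r $ i)\<^sup>2
      = - (A (x' - x) $ i * (x' $ i - x $ i)) - (x' $ i - x $ i)\<^sup>2 / dt - (rt $ i - r $ i)\<^sup>2"
    by (rule intermediate_energy_identity[OF dt motion chain])
  moreover have "(1 - \<psi>) / dt * (x' $ i - x $ i)\<^sup>2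
      = (x' $ i - x $ i)\<^sup>2 / dt - \<psi> / dt * (x' $ i - x $ i)\<^sup>2"
    by (simp add: left_diff_distrib diff_divide_distrib)
  ultimately show ?thesis
    using zero_le_power2[of "rt $ i - r $ i"] by linarith
qed

lemma norm_power2_eq_sum_components:
  fixes v :: "real ^ 'm::finite"
  shows "(norm v)\<^sup>2 = (\<Sum>i\<in>UNIV. (v $ i)\<^sup>2)"
  unfolding power2_norm_eq_inner inner_vec_def by (simp add: power2_eq_square)

lemma ersav_step_dissipation:
  fixes x r x' r' :: "real ^ 'm::finite"
  assumes dt: "dt \<noteq> 0" and step: "ersav_step f A dt \<psi> x r x' r'"
  shows "(norm r')\<^sup>2 - (norm r)\<^sup>2
           \<le> - (A (x' - x) \<bullet> (x' - x)) - (1 - \<psi>) / dt * (norm (x' - x))\<^sup>2"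
proof -
  have "(norm r')\<^sup>2 - (norm r)\<^sup>2 = (\<Sum>i\<in>UNIV. (r' $ i)\<^sup>2 - (r $ i)\<^sup>2)"
    by (simp add: norm_power2_eq_sum_components sum_subtractf)
  also have "\<dots> \<le> (\<Sum>i\<in>UNIV. - (A (x' - x) $ i * (x' $ i - x $ i))
                              - (1 - \<psi>) / dt * (x' $ i - x $ i)\<^sup>2)"
    by (rule sum_mono) (rule ersav_step_component_dissipation[OF dt step])
  also have "\<dots> = - (A (x' - x) \<bullet> (x' - x)) - (1 - \<psi>) / dt * (norm (x' - x))\<^sup>2"
    by (simp add: norm_power2_eq_sum_components inner_vec_def sum_subtractf sum_negf
        sum_distrib_left)
  finally show ?thesis .
qed

theorem theorem2p3:
  fixes f :: "real ^ 'm::finite \<Rightarrow> real"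
    and L :: "nat \<Rightarrow> real ^ 'm \<Rightarrow> real ^ 'm"
    and x r :: "nat \<Rightarrow> real ^ 'm"
    and \<delta> \<psi> dt :: real
  assumes "\<And>y. f differentiable (at y)"
    and "\<delta> > 0"
    and "\<And>y. f y \<ge> \<delta>"
    and "0 < \<psi>" and "\<psi> < 1"
    and "\<And>n. selfadjoint_psd (L n)"
    and "dt > 0"
    and "ersav_iterates f L dt \<psi> x r"
  shows "(\<forall>n. (norm (r (Suc n)))\<^sup>2 - (norm (r n))\<^sup>2
              \<le> - (L n (x (Suc n) - x n) \<bullet> (x (Suc n) - x n))
                 - (1 - \<psi>) / dt * (norm (x (Suc n) - x n))\<^sup>2
            \<and> - (L n (x (Suc n) - x n) \<bullet> (x (Suc n) - x n))
                 - (1 - \<psi>) / dt * (norm (x (Suc n) - x n))\<^sup>2 \<le> 0)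
       \<and> (\<forall>lam :: nat \<Rightarrow> 'm \<Rightarrow> real.
            (\<forall>n i. lam n i \<ge> 0) \<longrightarrow> (\<forall>n y i. L n y $ i = lam n i * y $ i) \<longrightarrow>
            (\<forall>n i. (r (Suc n) $ i)\<^sup>2 - (r n $ i)\<^sup>2
                     \<le> - ((1 - \<psi>) / dt * (x (Suc n) $ i - x n $ i)\<^sup>2)
                 \<and> - ((1 - \<psi>) / dt * (x (Suc n) $ i - x n $ i)\<^sup>2) \<le> 0))"
proof -
  have step: "ersav_step f (L n) dt \<psi> (x n) (r n) (x (Suc n)) (r (Suc n))" for n
    using assms(8) unfolding ersav_iterates_def by blast
  have dt: "dt \<noteq> 0" and coeff: "0 \<le> (1 - \<psi>) / dt"
    using \<open>\<psi> < 1\<close> \<open>dt > 0\<close> by auto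
  have psd: "0 \<le> L n v \<bullet> v" for n v
    using assms(6) unfolding selfadjoint_psd_def by blast
  show ?thesis
  proof (intro conjI allI impI)
    fix n
    show "(norm (r (Suc n)))\<^sup>2 - (norm (r n))\<^sup>2
            \<le> - (L n (x (Suc n) - x n) \<bullet> (x (Suc n) - x n))
               - (1 - \<psi>) / dt * (norm (x (Suc n) - x n))\<^sup>2"
      by (rule ersav_step_dissipation[OF dt step])
    have "0 \<le> (1 - \<psi>) / dt * (norm (x (Suc n) - x n))\<^sup>2"
      using coeff by (rule mult_nonneg_nonneg) simp
    then show "- (L n (x (Suc n) - x n) \<bullet> (x (Suc n) - x n))
               - (1 - \<psi>) / dt * (norm (x (Suc n) - x n))\<^sup>2 \<le> 0"
      using psd[of n "x (Suc n) - x n"] by linarith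
  next
    fix lam :: "nat \<Rightarrow> 'm \<Rightarrow> real" and n i
    assume lam: "\<forall>n i. lam n i \<ge> 0" and diag: "\<forall>n y i. L n y $ i = lam n i * y $ i"
    have "L n (x (Suc n) - x n) $ i * (x (Suc n) $ i - x n $ i)
            = lam n i * (x (Suc n) $ i - x n $ i)\<^sup>2"
      using diag by (simp add: power2_eq_square)
    moreover have "0 \<le> lam n i * (x (Suc n) $ i - x n $ i)\<^sup>2"
      using lam by simp
    ultimately show "(r (Suc n) $ i)\<^sup>2 - (r n $ i)\<^sup>2
        \<le> - ((1 - \<psi>) / dt * (x (Suc n) $ i - x n $ i)\<^sup>2)"
      using ersav_step_component_dissipation[OF dt step, of n i] by linarith
    have "0 \<le> (1 - \<psi>) / dt * (x (Suc n) $ i - x n $ i)\<^sup>2"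
      using coeff by (rule mult_nonneg_nonneg) simp
    then show "- ((1 - \<psi>) / dt * (x (Suc n) $ i - x n $ i)\<^sup>2) \<le> 0"
      by linarith
  qed
qed

end
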